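(* Let $a_0\in\{0,1\}$, let $a_1,a_3,a_5,\dots$ (all odd-indexed $a_{2m+1}$, $m\ge 0$) be arbitrary real numbers, and let $b_i=(i+a_0)\bmod 2$ for $i\ge 0$ (so $b_0=a_0$, $b_{2m}=a_0$ and $b_{2m+1}=1-b_{2m}$). Let $t(i,j)$ be the zero-sum triangle (defined in the context) with left boundary $(a_i)$ and right boundary $(b_i)$, where the even-indexed left boundary values $a_{2m}$, $m\ge 1$, are determined recursively by $$a_{2m}=\begin{cases}\displaystyle\sum_{k=1}^{2m-1}t(2m,k)a_k & \text{if } a_0=0,\\[2mm] \displaystyle\sum_{k=0}^{2m-2}t(2m-1,k)a_{k+1} & \text{if } a_0=1\end{cases}$$ (the right-hand sides depend only on $a_1,\dots,a_{2m-1}$ and $b_0,\dots,b_{2m}$). For $n\ge1$ let $T_n$ be the $n\times n$ lower triangular matrix with $T_n(i+1,j+1)=t(i,j)$ for $0\le j\le i\le n-1$ and zeros above the diagonal. Then $T_n^2=T_n$ for every $n\ge 1$. Moreover, with $s_0(i)=\sum_{k=0}^{i}t(i,k)a_k$, $s_1(i)=\sum_{k=0}^{i}t(i,k)a_{k+1}$, $s_{-1}(i)=\sum_{k=1}^{i}t(i,k)a_{k-1}$, one has $s_0(0)=a_0$, $s_1(0)=a_0a_1$, $s_{-1}(1)=0$, and for all $i\ge 1$: $$s_0(i)=a_i,\qquad s_1(i)=a_0\{a_i+a_{i+1}\}-a_i,\qquad s_{-1}(i)=0.$$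
   Context: Zero-sum triangle: given sequences $(a_i)_{i\ge0}$, $(b_i)_{i\ge0}$ with $b_0=a_0$, define numbers $t(i,j)$ for integers $0\le j\le i$ by $t(i,0)=a_i$ for $i\ge 0$, $t(i,i)=b_i$ for $i\ge 1$, and for $0<j<i$ by the zero-sum rule $t(i,j)+t(i-1,j-1)+t(i-1,j)=0$, i.e. $t(i,j)=-t(i-1,j-1)-t(i-1,j)$. *)

theory Defs
  imports Complex_Main "Jordan_Normal_Form.Matrix"
begin

text \<open>
  The value \<open>0\<close> for \<open>i < j\<close> is a dummy: the triangle only has entries with \<open>j \<le> i\<close>.
\<close>

fun zst :: "(nat \<Rightarrow> real) \<Rightarrow> (nat \<Rightarrow> real) \<Rightarrow> nat \<Rightarrow> nat \<Rightarrow> real" where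
  "zst a b i j =
    (if j = 0 then a i
     else if j = i then b i
     else if j < i then - zst a b (i - 1) (j - 1) - zst a b (i - 1) j
     else 0)"

declare zst.simps [simp del]

definition even_left :: "nat \<Rightarrow> (nat \<Rightarrow> real) \<Rightarrow> (nat \<Rightarrow> real) \<Rightarrow> nat \<Rightarrow> real" where
  "even_left a0 a b m =
    (if a0 = 0 then (\<Sum>k = 1..2 * m - 1. zst a b (2 * m) k * a k)
     else (\<Sum>k = 0..2 * m - 2. zst a b (2 * m - 1) k * a (k + 1)))"

text \<open>
  Rows and columns of \<open>mat\<close> are numbered from \<open>0\<close>, so entry \<open>(i, j)\<close> here is the entry
  usually written \<open>(i + 1, j + 1)\<close>.
\<close>

definition zst_mat :: "(nat \<Rightarrow> real) \<Rightarrow> (nat \<Rightarrow> real) \<Rightarrow> nat \<Rightarrow> real mat" where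
  "zst_mat a b n = mat n n (\<lambda>(i, j). if j \<le> i then zst a b i j else 0)"

lemma zst_cong:
  assumes "\<And>k. k \<le> i \<Longrightarrow> a k = a' k"
  shows "zst a b i j = zst a' b i j"
  using assms
proof (induction i arbitrary: j)
  case 0
  then show ?case by (simp add: zst.simps)
next
  case (Suc i)
  have "zst a b i j' = zst a' b i j'" for j' using Suc by simp
  then show ?case using Suc.prems by (subst (1 2) zst.simps) simp
qed

lemma zst_cong_less:
  assumes "\<And>k. k < i \<Longrightarrow> a k = a' k" and "0 < j"
  shows "zst a b i j = zst a' b i j"
proof -
  have "zst a b (i - 1) j' = zst a' b (i - 1) j'" if "j < i" for j'
    by (rule zst_cong) (use assms that in auto)
  then show ?thesis using assms(2) by (subst (1 2) zst.simps) auto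
qed

lemma even_left_cong:
  assumes "\<And>k. k < 2 * m \<Longrightarrow> a k = a' k" and "1 \<le> m"
  shows "even_left a0 a b m = even_left a0 a' b m"
proof -
  have "zst a b (2 * m) k * a k = zst a' b (2 * m) k * a' k" if "k \<in> {1..2 * m - 1}" for k
    using that assms zst_cong_less[of "2 * m" a a' k b] by auto
  moreover have "zst a b (2 * m - 1) k * a (k + 1) = zst a' b (2 * m - 1) k * a' (k + 1)"
    if "k \<in> {0..2 * m - 2}" for k
  proof -
    have "zst a b (2 * m - 1) k = zst a' b (2 * m - 1) k"
      by (rule zst_cong) (use assms in auto)
    moreover have "a (k + 1) = a' (k + 1)" using that assms by auto
    ultimately show ?thesis by simp
  qed
  ultimately show ?thesis unfolding even_left_def by simp
qed

function left_seq :: "nat \<Rightarrow> (nat \<Rightarrow> real) \<Rightarrow> (nat \<Rightarrow> real) \<Rightarrow> nat \<Rightarrow> real" where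
  "left_seq a0 c b n =
    (if n = 0 then real a0
     else if odd n then c (n div 2)
     else even_left a0 (\<lambda>k. if k < n then left_seq a0 c b k else 0) b (n div 2))"
  by auto
termination by (relation "measure (\<lambda>(a0, c, b, n). n)") auto

declare left_seq.simps [simp del]

text \<open>
  The recursion for the even-indexed left boundary values is well-founded: for every choice of
  the odd-indexed values there is exactly one left boundary satisfying it.
\<close>

lemma left_boundary_ex1:
  "\<exists>!a. a 0 = real a0 \<and> (\<forall>m. a (2 * m + 1) = c m) \<and> (\<forall>m\<ge>1. a (2 * m) = even_left a0 a b m)"
proof (rule ex1I[of _ "left_seq a0 c b"], intro conjI allI impI)
  show "left_seq a0 c b 0 = real a0" by (simp add: left_seq.simps)
  show "left_seq a0 c b (2 * m + 1) = c m" for m by (simp add: left_seq.simps)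
  show "left_seq a0 c b (2 * m) = even_left a0 (left_seq a0 c b) b m" if "1 \<le> m" for m
  proof -
    have "left_seq a0 c b (2 * m) =
        even_left a0 (\<lambda>k. if k < 2 * m then left_seq a0 c b k else 0) b m"
      using that by (subst left_seq.simps) simp
    also have "\<dots> = even_left a0 (left_seq a0 c b) b m"
      by (rule even_left_cong) (use that in auto)
    finally show ?thesis .
  qed
next
  fix a
  assume a: "a 0 = real a0 \<and> (\<forall>m. a (2 * m + 1) = c m) \<and> (\<forall>m\<ge>1. a (2 * m) = even_left a0 a b m)"
  have "a n = left_seq a0 c b n" for n
  proof (induction n rule: less_induct)
    case (less n)
    consider "n = 0" | m where "n = 2 * m + 1" | m where "n = 2 * m" "1 \<le> m"
      by (metis One_nat_def Suc_leI evenE mult_0_right neq0_conv oddE)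
    then show ?case
    proof cases
      case 1
      then show ?thesis using a by (simp add: left_seq.simps)
    next
      case 2
      then show ?thesis using a by (simp add: left_seq.simps)
    next
      case (3 m)
      have "even_left a0 a b m = even_left a0 (\<lambda>k. if k < n then left_seq a0 c b k else 0) b m"
        by (rule even_left_cong) (use 3 less in auto)
      then show ?thesis using a 3 by (subst left_seq.simps) simp
    qed
  qed
  then show "a = left_seq a0 c b" by blast
qed

end

theory Submission
  imports Defs
begin

text \<open>
  Because \<open>b (i + 1) + b i = 1\<close>, the zero-sum rule extends to all \<open>i, j\<close> as
  \<open>U T + T U + T = U + c e\<^sub>0\<^sup>T\<close>, where \<open>T\<close> is the infinite triangle, \<open>U\<close> the shift with entries
  \<open>U i (i + 1) = 1\<close>, and \<open>c i = a i + a (i + 1)\<close>. It follows that \<open>E = T\<^sup>2 - T\<close> satisfies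
  \<open>U E - E U = (a 0 c - T c) e\<^sub>0\<^sup>T\<close>, so \<open>E\<close> is a Toeplitz matrix and vanishes as soon as its first
  column does, that is, as soon as \<open>T a = a\<close>. This is shown entry by entry: if the first \<open>n\<close>
  entries of that column vanish, then in the leading \<open>(n + 1) \<times> (n + 1)\<close> block \<open>E\<close> has at most the
  bottom left entry \<open>e\<close>, and \<open>E T = T E\<close> reads \<open>a 0 e = b n e\<close>, forcing \<open>e = 0\<close> for odd \<open>n\<close>; for
  even \<open>n\<close> the equation \<open>e = 0\<close> is equivalent to the recursion that defines \<open>a n\<close>.
\<close>

lemma zst_0: "zst a b i 0 = a i"
  by (simp add: zst.simps)

lemma zst_above_diag: "i < j \<Longrightarrow> zst a b i j = 0"
  by (simp add: zst.simps)

locale alternating_zero_sum_triangle =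
  fixes a b :: "nat \<Rightarrow> real"
  assumes b_0: "b 0 = a 0"
    and b_Suc: "b (Suc i) = 1 - b i"
begin

abbreviation t :: "nat \<Rightarrow> nat \<Rightarrow> real" where
  "t \<equiv> zst a b"

definition row_prod :: "(nat \<Rightarrow> real) \<Rightarrow> nat \<Rightarrow> real" where
  "row_prod x i = (\<Sum>k\<le>i. t i k * x k)"

definition idem_defect :: "nat \<Rightarrow> nat \<Rightarrow> real" where
  "idem_defect i j = row_prod (\<lambda>k. t k j) i - t i j"

lemma zst_diag: "t i i = b i"
  using b_0 by (simp add: zst.simps)

text \<open>On the diagonal the excess is \<open>b (Suc i) + b i = 1\<close>, because
  \<open>t i (Suc i)\<close> is the dummy \<open>0\<close>; above it only dummies occur.\<close>

lemma zst_Suc_Suc: "t (Suc i) (Suc j) = (if i = j then 1 else 0) - t i j - t i (Suc j)"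
proof (cases i j rule: linorder_cases)
  case less
  then show ?thesis by (simp add: zst_above_diag)
next
  case equal
  then show ?thesis by (simp add: zst_diag zst_above_diag b_Suc)
next
  case greater
  then show ?thesis by (subst zst.simps) simp
qed

lemma row_prod_extend: "i \<le> n \<Longrightarrow> row_prod x i = (\<Sum>k\<le>n. t i k * x k)"
  unfolding row_prod_def by (rule sum.mono_neutral_left) (auto simp: zst_above_diag)

lemma row_prod_diff: "row_prod (\<lambda>k. x k - y k) i = row_prod x i - row_prod y i"
  by (simp add: row_prod_def right_diff_distrib sum_subtractf)

lemma row_prod_delta: "row_prod (\<lambda>k. if k = j then 1 else 0) i = t i j"
  by (auto simp: row_prod_def zst_above_diag if_distrib[of "\<lambda>x. _ * x"] cong: if_cong)

text \<open>Column \<open>0\<close> does not obey the zero-sum rule, so it is split off; this leaves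
  the correction \<open>(a (Suc i) + a i) * x 0\<close>.\<close>

lemma row_prod_Suc:
  "row_prod x (Suc i) =
    (a (Suc i) + a i) * x 0 + x (Suc i) - row_prod (\<lambda>k. x (Suc k)) i - row_prod x i"
proof -
  have shifted: "row_prod x i = a i * x 0 + (\<Sum>k\<le>i. t i (Suc k) * x (Suc k))"
    by (subst row_prod_extend[of i "Suc i"])
      (simp_all add: sum.atMost_Suc_shift zst_0 del: sum.atMost_Suc)
  have "row_prod x (Suc i) = a (Suc i) * x 0 + (\<Sum>k\<le>i. t (Suc i) (Suc k) * x (Suc k))"
    by (simp add: row_prod_def sum.atMost_Suc_shift zst_0 del: sum.atMost_Suc)
  also have "(\<Sum>k\<le>i. t (Suc i) (Suc k) * x (Suc k)) =
      (\<Sum>k\<le>i. (if k = i then x (Suc k) else 0) - t i k * x (Suc k) - t i (Suc k) * x (Suc k))"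
    by (rule sum.cong) (auto simp: zst_Suc_Suc algebra_simps)
  also have "\<dots> = x (Suc i) - row_prod (\<lambda>k. x (Suc k)) i - (row_prod x i - a i * x 0)"
    by (simp add: sum_subtractf shifted) (simp add: row_prod_def)
  finally show ?thesis by (simp add: algebra_simps)
qed

text \<open>In \<open>row_prod_Suc\<close> for column \<open>Suc j\<close> the correction vanishes,
  as \<open>t 0 (Suc j) = 0\<close>, and the two products with column \<open>Suc j\<close>
  cancel.\<close>

lemma idem_defect_Suc_Suc: "idem_defect (Suc i) (Suc j) = idem_defect i j"
proof -
  have "row_prod (\<lambda>k. t (Suc k) (Suc j)) i =
      t i j - row_prod (\<lambda>k. t k j) i - row_prod (\<lambda>k. t k (Suc j)) i"
    by (simp add: zst_Suc_Suc row_prod_diff row_prod_delta)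
  then show ?thesis
    by (simp add: idem_defect_def row_prod_Suc zst_above_diag)
qed

lemma idem_defect_toeplitz: "j \<le> i \<Longrightarrow> idem_defect i j = idem_defect (i - j) 0"
proof (induction j arbitrary: i)
  case (Suc j)
  then show ?case by (cases i) (auto simp: idem_defect_Suc_Suc)
qed simp

lemma idem_defect_0: "idem_defect i 0 = row_prod a i - a i"
  by (simp add: idem_defect_def zst_0)

text \<open>Both sides are entries of \<open>T^3 - T^2\<close>; triangularity lets all sums be cut
  at \<open>n\<close>.\<close>

lemma idem_defect_commute:
  "(\<Sum>k\<le>n. t n k * idem_defect k j) = (\<Sum>k\<le>n. idem_defect n k * t k j)"
proof -
  have "(\<Sum>k\<le>n. t n k * row_prod (\<lambda>l. t l j) k) = (\<Sum>k\<le>n. \<Sum>l\<le>n. t n k * (t k l * t l j))"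
    by (rule sum.cong) (auto simp: row_prod_extend[of _ n] sum_distrib_left)
  also have "\<dots> = (\<Sum>l\<le>n. \<Sum>k\<le>n. t n k * (t k l * t l j))"
    by (rule sum.swap)
  also have "\<dots> = (\<Sum>l\<le>n. row_prod (\<lambda>k. t k l) n * t l j)"
    by (simp add: row_prod_def sum_distrib_right mult.assoc)
  finally show ?thesis
    by (simp add: idem_defect_def algebra_simps sum_subtractf)
qed

lemma idem_defect_0_if_diag_neq:
  assumes zero: "\<And>k. k < n \<Longrightarrow> idem_defect k 0 = 0" and "b n \<noteq> a 0"
  shows "idem_defect n 0 = 0"
proof -
  \<comment> \<open>Here only \<open>k = n\<close> survives, and on the other side only
    \<open>k = 0\<close>, since \<open>idem_defect n k\<close> equals
    \<open>idem_defect (n - k) 0\<close>.\<close>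
  have "(\<Sum>k\<le>n. t n k * idem_defect k 0) = (\<Sum>k\<in>{n}. t n k * idem_defect k 0)"
    by (rule sum.mono_neutral_right) (auto simp: zero)
  moreover have "(\<Sum>k\<le>n. idem_defect n k * t k 0) = (\<Sum>k\<in>{0}. idem_defect n k * t k 0)"
    by (rule sum.mono_neutral_right) (auto simp: zero idem_defect_toeplitz[of "Suc _"] gr0_conv_Suc)
  ultimately have "b n * idem_defect n 0 = idem_defect n 0 * a 0"
    using idem_defect_commute[of n 0] by (simp add: zst_diag zst_0)
  then show ?thesis using \<open>b n \<noteq> a 0\<close> by auto
qed

lemma zst_mat_idempotent:
  assumes fix_a: "\<And>i. row_prod a i = a i"
  shows "zst_mat a b n ^\<^sub>m 2 = zst_mat a b n"
proof -
  have entry: "zst_mat a b n = mat n n (\<lambda>(i, j). t i j)"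
    unfolding zst_mat_def by (rule eq_matI) (auto simp: zst_above_diag)
  have defect: "idem_defect i j = 0" for i j
  proof (cases "j \<le> i")
    case True
    then show ?thesis by (subst idem_defect_toeplitz) (simp_all add: idem_defect_0 fix_a)
  next
    case False
    then show ?thesis by (simp add: idem_defect_def row_prod_def zst_above_diag)
  qed
  have "(\<Sum>k = 0..<n. t i k * t k j) = t i j" if "i < n" for i j
  proof -
    have "(\<Sum>k = 0..<n. t i k * t k j) = row_prod (\<lambda>k. t k j) i"
      unfolding row_prod_def
      by (rule sum.mono_neutral_right) (use that in \<open>auto simp: zst_above_diag\<close>)
    then show ?thesis using defect[of i j] by (simp add: idem_defect_def)
  qed
  then have "zst_mat a b n * zst_mat a b n = zst_mat a b n"
    unfolding entry by (intro eq_matI) (auto simp: scalar_prod_def)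
  moreover have "zst_mat a b n \<in> carrier_mat n n"
    by (simp add: zst_mat_def)
  ultimately show ?thesis by (simp add: numeral_2_eq_2)
qed

text \<open>The left shift of \<open>case_nat 0 a\<close> is \<open>a\<close> itself, so
  \<open>row_prod_Suc\<close> gives \<open>a i - row_prod a i = 0\<close> in the induction
  step.\<close>

lemma row_prod_right_shift:
  assumes fix_a: "\<And>i. row_prod a i = a i"
  shows "row_prod (case_nat 0 a) i = 0"
proof (induction i)
  case 0
  show ?case by (simp add: row_prod_def)
next
  case (Suc i)
  then show ?case by (simp add: row_prod_Suc fix_a)
qed

lemma row_prod_left_shift:
  assumes fix_a: "\<And>i. row_prod a i = a i"
  shows "row_prod (\<lambda>k. a (Suc k)) i = a 0 * (a i + a (Suc i)) - a i"
  using row_prod_Suc[of a i] by (simp add: fix_a algebra_simps)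

end

theorem theorem1:
  fixes a0 :: nat and a b :: "nat \<Rightarrow> real"
  assumes a0: "a0 \<in> {0, 1}"
    and a_0: "a 0 = real a0"
    and b: "\<And>i. b i = real ((i + a0) mod 2)"
    and a_even: "\<And>m. m \<ge> 1 \<Longrightarrow> a (2 * m) =
      (if a0 = 0 then (\<Sum>k = 1..2 * m - 1. zst a b (2 * m) k * a k)
       else (\<Sum>k = 0..2 * m - 2. zst a b (2 * m - 1) k * a (k + 1)))"
  defines "s0 \<equiv> \<lambda>i. \<Sum>k = 0..i. zst a b i k * a k"
    and "s1 \<equiv> \<lambda>i. \<Sum>k = 0..i. zst a b i k * a (k + 1)"
    and "sm1 \<equiv> \<lambda>i. \<Sum>k = 1..i. zst a b i k * a (k - 1)"
  shows "(\<forall>n\<ge>1. zst_mat a b n ^\<^sub>m 2 = zst_mat a b n) \<and>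
    s0 0 = a 0 \<and> s1 0 = a 0 * a 1 \<and> sm1 1 = 0 \<and>
    (\<forall>i\<ge>1. s0 i = a i \<and> s1 i = a 0 * (a i + a (i + 1)) - a i \<and> sm1 i = 0)"
proof -
  interpret alternating_zero_sum_triangle a b
    by standard (use a0 in \<open>auto simp: a_0 b mod_Suc\<close>)
  have fix_a: "row_prod a n = a n" for n
  proof (induction n rule: less_induct)
    case (less n)
    consider "n = 0" | "odd n" | m where "n = 2 * Suc m"
      by (metis evenE mult_0_right not0_implies_Suc)
    then show ?case
    proof cases
      case 1
      then show ?thesis using a0 a_0 by (auto simp: row_prod_def zst_0)
    next
      case 2
      then have "b n \<noteq> a 0"
        using a0 by (auto simp: a_0 b odd_iff_mod_2_eq_one mod_Suc)
      then show ?thesis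
        using idem_defect_0_if_diag_neq[of n] less by (simp add: idem_defect_0)
    next
      case (3 m)
      show ?thesis
      proof (cases "a0 = 0")
        case True
        \<comment> \<open>The unknown \<open>a n\<close> drops out of the last term, and
          \<open>a 0 = 0\<close> removes the first: the rest is the sum defining
          \<open>a n\<close>.\<close>
        then have "b n = 0" using 3 by (simp add: b)
        then have "row_prod a n = (\<Sum>k\<le>Suc (2 * m). t n k * a k)"
          using 3 by (simp add: row_prod_def zst_diag)
        also have "\<dots> = (\<Sum>k = 1..Suc (2 * m). t n k * a k)"
          by (rule sum.mono_neutral_right) (auto simp: True a_0 not_less_eq_eq)
        also have "\<dots> = a n"
          using a_even[of "Suc m"] True 3 by simp
        finally show ?thesis .
      next
        case False
        then have a0_1: "a0 = 1" using a0 by simp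
        \<comment> \<open>Row \<open>n\<close> contains \<open>a n\<close> at both ends, so the
          argument passes to the odd row \<open>p\<close>, where \<open>b p = 0\<close> and the
          shifted product is the sum defining \<open>a n\<close>.\<close>
        define p where "p = Suc (2 * m)"
        have n: "n = Suc p" using 3 by (simp add: p_def)
        have "b p = 0" by (simp add: b a0_1 p_def)
        then have "row_prod (\<lambda>k. a (Suc k)) p = (\<Sum>k = 0..2 * m. t p k * a (Suc k))"
          by (simp add: row_prod_def p_def zst_diag atLeast0AtMost)
        also have "\<dots> = a n"
          using a_even[of "Suc m"] a0_1 3 by (simp add: p_def)
        finally show ?thesis
          using row_prod_Suc[of a p] less[of p] by (simp add: n a_0 a0_1)
      qed
    qed
  qed
  have s0: "s0 i = row_prod a i" for i
    by (simp add: s0_def row_prod_def atLeast0AtMost)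
  have s1: "s1 i = row_prod (\<lambda>k. a (Suc k)) i" for i
    by (simp add: s1_def row_prod_def atLeast0AtMost)
  \<comment> \<open>The leading \<open>0\<close> of \<open>case_nat 0 a\<close> supplies the missing
    term \<open>k = 0\<close>.\<close>
  have sm1: "sm1 i = row_prod (case_nat 0 a) i" for i
    unfolding sm1_def row_prod_def
    by (rule sum.mono_neutral_cong_left) (auto split: nat.split)
  have "s1 0 = a 0 * a 1"
    by (simp add: s1_def zst_0)
  then show ?thesis
    using zst_mat_idempotent[OF fix_a]
    by (simp add: s0 s1 sm1 fix_a row_prod_left_shift[OF fix_a] row_prod_right_shift[OF fix_a])
qed

end
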